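(* Suppose that there exist scalars $D_1,D_2\ge 0$, independent of $N$, such that, for Hölder-conjugate exponent pairs $(q_1,q_1')$ and $(q_2,q_2')$, we have for all $N\in\mathbb{N}$: (a) $\left\| \mathbb{E}_{\nu_N}\left[ \left( e^{-\Phi/2}+e^{-\Phi_N/2} \right)^{2q_1} \right]^{1/q_1} \right\|_{L^{q_2}_{\mu_0}(\mathcal{U})} \le D_1 = D_1(q_1,q_2)$; (b) $\left\| \mathbb{E}_{\nu_N}\left[ \left( Z_N^{\mathrm{S}} \max\{ Z^{-3}, (Z_N^{\mathrm{S}})^{-3} \} \left( e^{-\Phi}+e^{-\Phi_N} \right)^2 \right)^{q_1} \right]^{1/q_1} \right\|_{L^{q_2}_{\mu_0}(\mathcal{U})} \le D_2 = D_2(q_1,q_2)$. Then, for all $N$, $$ \mathbb{E}_{\nu_N}\left[ d_{\mathrm{H}}(\mu,\mu_N^{\mathrm{S}})^2 \right]^{1/2} \le (D_1+D_2) \left\| \mathbb{E}_{\nu_N}\left[ |\Phi-\Phi_N|^{2q_1'} \right]^{1/(2q_1')} \right\|_{L^{2q_2'}_{\mu_0}(\mathcal{U})}. $$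
   Context: $\mathcal{U}$ is a separable Banach space with its Borel $\sigma$-algebra, $\mu_0$ is a probability measure (prior) on $\mathcal{U}$, and $\Phi:\mathcal{U}\to\mathbb{R}$ is a measurable function (negative log-likelihood; the data are fixed) with $Z := \mathbb{E}_{\mu_0}[\exp(-\Phi)] \in (0,\infty)$. The exact posterior $\mu$ is the probability measure with $\frac{d\mu}{d\mu_0}(u) = \exp(-\Phi(u))/Z$. For each $N\in\mathbb{N}$, $\Phi_N:\Omega\times\mathcal{U}\to\mathbb{R}$ is a measurable function (random approximation of $\Phi$) and $\nu_N$ is a probability measure on $\Omega$; the arguments $(\omega,u)$ of $\Phi_N$ are distributed as $\nu_N\otimes\mu_0$, i.e. the randomness of $\Phi_N$ is independent of $u$. $\mathbb{E}_{\nu_N}[\cdot]$ denotes integration over $\omega$ only, so the expectations in (a), (b) are functions of $u\in\mathcal{U}$. The random normalising constant and the sample approximate posterior (a random probability measure on $\mathcal{U}$) are $$Z_N^{\mathrm{S}}(\omega) := \mathbb{E}_{\mu_0}[\exp(-\Phi_N(\omega,\cdot))], \qquad \frac{d\mu_N^{\mathrm{S}}}{d\mu_0}(\omega,u) := \frac{\exp(-\Phi_N(\omega,u))}{Z_N^{\mathrm{S}}(\omega)}.$$ The Hellinger distance of probability measures $\mu,\nu$ absolutely continuous with respect to a reference measure $\pi$ is $d_{\mathrm{H}}(\mu,\nu)^2 := \frac12\int_{\mathcal{U}} \left| \sqrt{d\mu/d\pi}-\sqrt{d\nu/d\pi}\right|^2 d\pi$. Hölder-conjugate exponents lie in $[1,\infty]$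 with $1/q+1/q'=1$; for an infinite exponent, $\mathbb{E}_{\nu_N}[|X|^q]^{1/q}$ is read as the $\nu_N$-essential supremum of $|X|$ (and $\mathbb{E}_{\nu_N}[|X|^{2q}]^{1/q}$ as the essential supremum of $|X|^2$). *)

theory Defs
  imports "HOL-Probability.Probability" "HOL-Probability.Essential_Supremum"
begin

(* x ^ r on [0, infinity]; only used for exponents r > 0. *)
definition enn_powr :: "ennreal \<Rightarrow> real \<Rightarrow> ennreal"
  where "enn_powr x r = (if x = \<top> then \<top> else ennreal (enn2real x powr r))"

(* Exponents live in ennreal, so q may be infinite; there inverse \<top> = 0. *)
definition conjugate_exponents :: "ennreal \<Rightarrow> ennreal \<Rightarrow> bool"
  where "conjugate_exponents q q' \<longleftrightarrow> 1 \<le> q \<and> 1 \<le> q' \<and> inverse q + inverse q' = 1"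

(* E[X ^ (k q)] ^ (1/q) for X with values in [0, infinity], read as the essential
   supremum of X ^ k when q is infinite. *)
definition rooted_moment :: "'a measure \<Rightarrow> nat \<Rightarrow> ennreal \<Rightarrow> ('a \<Rightarrow> ennreal) \<Rightarrow> ennreal"
  where "rooted_moment M k q X =
    (if q = \<top> then esssup M (\<lambda>x. X x ^ k)
     else enn_powr (\<integral>\<^sup>+ x. enn_powr (X x) (real k * enn2real q) \<partial>M) (1 / enn2real q))"

definition Lq_norm :: "'a measure \<Rightarrow> ennreal \<Rightarrow> ('a \<Rightarrow> ennreal) \<Rightarrow> ennreal"
  where "Lq_norm M q X = rooted_moment M 1 q X"

definition norm_const :: "'u measure \<Rightarrow> ('u \<Rightarrow> real) \<Rightarrow> ennreal"
  where "norm_const \<mu>0 \<Phi> = (\<integral>\<^sup>+ u. ennreal (exp (- \<Phi> u)) \<partial>\<mu>0)"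

definition posterior :: "'u measure \<Rightarrow> ('u \<Rightarrow> real) \<Rightarrow> 'u measure"
  where "posterior \<mu>0 \<Phi> = density \<mu>0 (\<lambda>u. ennreal (exp (- \<Phi> u)) / norm_const \<mu>0 \<Phi>)"

(* Meant for probability measures \<mu>, \<nu> that are absolutely continuous with respect to
   the reference measure \<pi>. *)
definition hellinger_dist :: "'u measure \<Rightarrow> 'u measure \<Rightarrow> 'u measure \<Rightarrow> ennreal"
  where "hellinger_dist \<pi> \<mu> \<nu> =
    enn_powr ((\<integral>\<^sup>+ u. ennreal (\<bar>sqrt (enn2real (RN_deriv \<pi> \<mu> u))
                               - sqrt (enn2real (RN_deriv \<pi> \<nu> u))\<bar>\<^sup>2) \<partial>\<pi>) / 2) (1 / 2)"

end

theory Submission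
  imports Defs
begin

text \<open>
  Write \<open>A = exp (- \<Phi>)\<close>, \<open>B = exp (- \<Phi>\<^sub>N)\<close>, \<open>d = \<bar>\<Phi> - \<Phi>\<^sub>N\<bar>\<close> and
  \<open>W = Z\<^sub>N * max (Z^-3) (Z\<^sub>N^-3) * (A + B)\<^sup>2\<close>, the quantity that hypothesis (b) bounds.
  Let \<open>X\<close> be the norm of \<open>d\<close> on the right-hand side. The proof splits into an estimate for a
  single sample, without any exponents, and one application of Hoelder's inequality in each
  variable.

  For one sample, the difference of the square roots of the two densities is
  \<open>(sqrt A - sqrt B) / sqrt Z + sqrt B * (1 / sqrt Z - 1 / sqrt Z\<^sub>N)\<close>.
  \<^item> The first summand has square at most \<open>(A + B) / Z * d\<^sup>2 / 4\<close>, since the exponential is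
    Lipschitz with the larger value as constant. By \<open>s \<le> (1 + s\<^sup>2) / 2\<close> for \<open>s = (A + B) / Z\<close>,
    and by \<open>Z^-2 \<le> Z\<^sub>N * max (Z^-3) (Z\<^sub>N^-3)\<close>, the factor \<open>(A + B) / Z\<close> is at most
    \<open>(1 + W) / 2\<close>. So no power of \<open>Z\<close> remains in front.
  \<^item> The second summand integrates to \<open>Z\<^sub>N * (1 / sqrt Z - 1 / sqrt Z\<^sub>N)\<^sup>2\<close>, at most a quarter of
    \<open>Z\<^sub>N * max (Z^-3) (Z\<^sub>N^-3) * (Z - Z\<^sub>N)\<^sup>2\<close>; and \<open>(Z - Z\<^sub>N)\<^sup>2\<close> is at most the prior mean of
    \<open>(A - B)\<^sup>2 \<le> (A + B)\<^sup>2 * d\<^sup>2\<close> by Cauchy--Schwarz.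

  Since \<open>(p + r)\<^sup>2 \<le> 2 * p\<^sup>2 + 2 * r\<^sup>2\<close>, the squared Hellinger distance is at most half the
  prior mean of \<open>(1 + W) * d\<^sup>2\<close> (\<open>hellinger_dist_posterior_square_le\<close>). Averaging over the samples and applying Hoelder's
  inequality in both variables (\<open>mixed_Holder\<close>) gives the bound \<open>(1 + D\<^sub>2) / 2 * X\<^sup>2\<close>.

  A square root of this would have \<open>D\<^sub>2\<close> under the root. It is converted to the linear form by
  \<open>1 \<le> D\<^sub>2\<close>: the prior mean of \<open>W\<close> is at least that of \<open>(A / Z)\<^sup>2\<close>, hence at least 1
  (\<open>nn_integral_weight_ge_1\<close>), and the mixed norm of \<open>W\<close> dominates its mean. Therefore
  \<open>(1 + D\<^sub>2) / 2 \<le> D\<^sub>2\<^sup>2 \<le> (D\<^sub>1 + D\<^sub>2)\<^sup>2\<close>.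
\<close>

section \<open>Powers and conjugate exponents\<close>

lemma enn_powr_top [simp]: "enn_powr \<top> r = \<top>"
  by (simp add: enn_powr_def)

lemma enn_powr_ennreal: "0 \<le> x \<Longrightarrow> enn_powr (ennreal x) r = ennreal (x powr r)"
  by (simp add: enn_powr_def)

lemma enn_powr_0 [simp]: "enn_powr 0 r = 0"
  by (simp add: enn_powr_def)

lemma enn_powr_1_left [simp]: "enn_powr 1 r = 1"
  by (simp add: enn_powr_def)

lemma enn_powr_1 [simp]: "enn_powr x 1 = x"
  by (cases x) (auto simp: enn_powr_ennreal)

lemma enn_powr_eq_0_iff [simp]: "enn_powr x r = 0 \<longleftrightarrow> x = 0"
  by (cases x) (auto simp: enn_powr_ennreal ennreal_eq_0_iff)

lemma enn_powr_mono: "x \<le> y \<Longrightarrow> 0 \<le> r \<Longrightarrow> enn_powr x r \<le> enn_powr y r"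
  by (cases x; cases y) (auto simp: enn_powr_ennreal top_unique intro!: ennreal_leI powr_mono2)

lemma enn_powr_powr: "enn_powr (enn_powr x r) s = enn_powr x (r * s)"
  by (cases x) (auto simp: enn_powr_ennreal powr_powr)

lemma enn_powr_2: "enn_powr x 2 = x ^ 2"
  by (cases x) (auto simp: enn_powr_ennreal ennreal_power)

lemma enn_powr_half_square: "(enn_powr x (1 / 2))\<^sup>2 = x"
  unfolding enn_powr_2[symmetric] by (simp add: enn_powr_powr)

lemma enn_powr_square_half: "enn_powr (x\<^sup>2) (1 / 2) = x"
  unfolding enn_powr_2[symmetric] by (simp add: enn_powr_powr)

lemma enn_powr_measurable [measurable (raw)]:
  assumes [measurable]: "f \<in> borel_measurable M"
  shows "(\<lambda>x. enn_powr (f x) r) \<in> borel_measurable M"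
  unfolding enn_powr_def by measurable

lemma conjugate_exponents_sym: "conjugate_exponents p q \<Longrightarrow> conjugate_exponents q p"
  by (simp add: conjugate_exponents_def add.commute)

lemma conjugate_exponents_top: "conjugate_exponents \<top> q \<Longrightarrow> q = 1"
  by (cases q) (auto simp: conjugate_exponents_def inverse_ennreal ennreal_eq_0_iff)

lemma conjugate_exponents_finite:
  assumes "conjugate_exponents p q" "p \<noteq> \<top>" "q \<noteq> \<top>"
  obtains "1 < enn2real p" "1 < enn2real q" "1 / enn2real p + 1 / enn2real q = 1"
proof -
  obtain r where r: "p = ennreal r" "0 \<le> r" using assms(2) by (cases p) auto
  obtain s where s: "q = ennreal s" "0 \<le> s" using assms(3) by (cases q) auto
  have "1 \<le> r" "1 \<le> s"
    using assms(1) r s by (auto simp: conjugate_exponents_def)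
  moreover from this have "1 / r + 1 / s = 1"
    using assms(1) r s
    by (auto simp: conjugate_exponents_def inverse_ennreal inverse_eq_divide
             simp flip: ennreal_plus)
  moreover from calculation have "r \<noteq> 1" "s \<noteq> 1" by auto
  ultimately show ?thesis using that r s by simp
qed

section \<open>Hoelder's inequality for moments with values in the extended half-line\<close>

lemma rooted_moment_finite_exponent:
  "q \<noteq> \<top> \<Longrightarrow> rooted_moment M 1 q f =
    enn_powr (\<integral>\<^sup>+x. enn_powr (f x) (enn2real q) \<partial>M) (1 / enn2real q)"
  by (simp add: rooted_moment_def)

text \<open>
  Young's inequality for \<open>x / s\<close> and \<open>y / t\<close>, multiplied by \<open>s * t\<close>. With \<open>s\<close> and \<open>t\<close> the norms of
  two functions, it integrates to Hoelder's inequality without normalising the functions.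
\<close>

lemma ennreal_Young:
  fixes x y :: ennreal and s t p q :: real
  assumes pq: "1 < p" "1 < q" "1 / p + 1 / q = 1" and st: "0 < s" "0 < t"
  shows "x * y \<le> ennreal (s * t / (p * s powr p)) * enn_powr x p
                 + ennreal (s * t / (q * t powr q)) * enn_powr y q"
proof (cases "x = \<top> \<or> y = \<top>")
  case True
  then show ?thesis using pq st by (auto simp: ennreal_mult_eq_top_iff ennreal_mult_top)
next
  case False
  then obtain a b where ab: "x = ennreal a" "0 \<le> a" "y = ennreal b" "0 \<le> b"
    by (cases x; cases y) auto
  have "a * b = s * t * ((a / s) * (b / t))" using st by simp
  also have "\<dots> \<le> s * t * ((a / s) powr p / p + (b / t) powr q / q)"
    using pq st ab by (intro mult_left_mono Youngs_inequality) auto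
  also have "\<dots> = s * t / (p * s powr p) * a powr p + s * t / (q * t powr q) * b powr q"
    using pq st ab by (simp add: powr_divide field_simps)
  finally show ?thesis
    using ab st pq
    by (simp add: enn_powr_ennreal ennreal_mult[symmetric] ennreal_plus[symmetric] del: ennreal_plus)
qed

lemma nn_integral_mult_le_esssup:
  assumes [measurable]: "f \<in> borel_measurable M" "g \<in> borel_measurable M"
  shows "(\<integral>\<^sup>+x. f x * g x \<partial>M) \<le> esssup M f * (\<integral>\<^sup>+x. g x \<partial>M)"
proof -
  have "(\<integral>\<^sup>+x. f x * g x \<partial>M) \<le> (\<integral>\<^sup>+x. esssup M f * g x \<partial>M)"
    using esssup_AE[where f = f and M = M]
    by (intro nn_integral_mono_AE) (auto elim!: eventually_mono intro: mult_right_mono)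
  then show ?thesis by (simp add: nn_integral_cmult)
qed

text \<open>
  For finite exponents and norms in \<open>(0, \<infinity>)\<close> this integrates the scaled Young inequality; if a
  norm vanishes, then so does the integrand almost everywhere, which makes \<open>0 * \<infinity> = 0\<close> the right
  convention in the bound. An infinite exponent forces its partner to be 1, and the essential
  supremum can be pulled out of the integral.
\<close>

lemma nn_integral_Holder:
  assumes pq: "conjugate_exponents p q"
    and [measurable]: "f \<in> borel_measurable M" "g \<in> borel_measurable M"
  shows "(\<integral>\<^sup>+x. f x * g x \<partial>M) \<le> rooted_moment M 1 p f * rooted_moment M 1 q g"
proof -
  consider "p = \<top>" | "q = \<top>" | "p \<noteq> \<top>" "q \<noteq> \<top>" by auto
  then show ?thesis
  proof cases
    case 1
    then have "q = 1" using pq conjugate_exponents_top by blast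
    then show ?thesis using 1 nn_integral_mult_le_esssup[of f M g]
      by (simp add: rooted_moment_def)
  next
    case 2
    then have "p = 1" using pq conjugate_exponents_sym conjugate_exponents_top by blast
    then show ?thesis using 2 nn_integral_mult_le_esssup[of g M f]
      by (simp add: rooted_moment_def mult.commute)
  next
    case 3
    define r where "r = enn2real p"
    define s where "s = enn2real q"
    have rs: "1 < r" "1 < s" "1 / r + 1 / s = 1"
      using conjugate_exponents_finite[OF pq 3] unfolding r_def s_def by blast+
    define F where "F = (\<integral>\<^sup>+x. enn_powr (f x) r \<partial>M)"
    define G where "G = (\<integral>\<^sup>+x. enn_powr (g x) s \<partial>M)"
    have norms: "rooted_moment M 1 p f = enn_powr F (1 / r)"
      "rooted_moment M 1 q g = enn_powr G (1 / s)"
      using 3 by (simp_all add: rooted_moment_finite_exponent F_def G_def r_def s_def del: One_nat_def)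
    consider "F = 0 \<or> G = 0" | "F \<noteq> 0" "G \<noteq> 0" "F = \<top> \<or> G = \<top>"
      | "F \<noteq> 0" "G \<noteq> 0" "F \<noteq> \<top>" "G \<noteq> \<top>" by blast
    then show ?thesis
    proof cases
      case 1
      then have "(AE x in M. f x = 0) \<or> (AE x in M. g x = 0)"
        by (auto simp: F_def G_def nn_integral_0_iff_AE)
      then have "AE x in M. f x * g x = 0" by (auto elim: eventually_mono)
      then have "(\<integral>\<^sup>+x. f x * g x \<partial>M) = 0" by (subst nn_integral_0_iff_AE) auto
      then show ?thesis by simp
    next
      case 2
      then show ?thesis unfolding norms by (auto simp: ennreal_mult_top ennreal_top_mult)
    next
      case 3
      then obtain a b where a: "F = ennreal a" "0 < a" and b: "G = ennreal b" "0 < b"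
        by (cases F; cases G) (auto simp: less_le)
      define \<sigma> where "\<sigma> = a powr (1 / r)"
      define \<tau> where "\<tau> = b powr (1 / s)"
      have pos: "0 < \<sigma>" "0 < \<tau>" using a b by (auto simp: \<sigma>_def \<tau>_def)
      have pw: "\<sigma> powr r = a" "\<tau> powr s = b"
        using rs a b by (auto simp: \<sigma>_def \<tau>_def powr_powr)
      have "(\<integral>\<^sup>+x. f x * g x \<partial>M)
          \<le> (\<integral>\<^sup>+x. ennreal (\<sigma> * \<tau> / (r * a)) * enn_powr (f x) r
                  + ennreal (\<sigma> * \<tau> / (s * b)) * enn_powr (g x) s \<partial>M)"
        using ennreal_Young[OF rs pos] unfolding pw by (intro nn_integral_mono)
      also have "\<dots> = ennreal (\<sigma> * \<tau> / (r * a)) * F + ennreal (\<sigma> * \<tau> / (s * b)) * G"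
        unfolding F_def G_def by (subst nn_integral_add) (auto simp: nn_integral_cmult)
      also have "\<dots> = ennreal (\<sigma> * \<tau> / (r * a) * a + \<sigma> * \<tau> / (s * b) * b)"
        using a b rs pos
        by (simp add: ennreal_mult[symmetric] ennreal_plus[symmetric] del: ennreal_plus)
      also have "\<sigma> * \<tau> / (r * a) * a + \<sigma> * \<tau> / (s * b) * b = \<sigma> * \<tau> * (1 / r + 1 / s)"
        using a b by (simp add: distrib_left)
      also have "ennreal \<dots> = enn_powr F (1 / r) * enn_powr G (1 / s)"
        unfolding rs(3) using a b by (simp add: enn_powr_ennreal \<sigma>_def \<tau>_def ennreal_mult)
      finally show ?thesis unfolding norms .
    qed
  qed
qed

text \<open>
  Trades the norm of \<open>f\<^sup>2\<close> with exponent \<open>q\<close>, as it comes out of Hoelder's inequality, for the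
  norm of \<open>f\<close> with exponent \<open>2 * q\<close>.
\<close>

lemma rooted_moment_square_le:
  assumes [measurable]: "f \<in> borel_measurable M"
  shows "rooted_moment M 1 q (\<lambda>x. (f x)\<^sup>2) \<le> (rooted_moment M 1 (2 * q) f)\<^sup>2"
proof (cases "q = \<top>")
  case True
  have "AE x in M. (f x)\<^sup>2 \<le> (esssup M f)\<^sup>2"
    using esssup_AE[where f = f and M = M] by (auto elim!: eventually_mono intro: power_mono)
  then show ?thesis
    using True by (auto simp: rooted_moment_def ennreal_mult_top intro!: esssup_I)
next
  case False
  then have 2: "2 * q \<noteq> \<top>" by (simp add: ennreal_mult_eq_top_iff)
  have *: "enn_powr (y\<^sup>2) (enn2real q) = enn_powr y (2 * enn2real q)" for y
    unfolding enn_powr_2[symmetric] by (rule enn_powr_powr)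
  show ?thesis
    unfolding rooted_moment_finite_exponent[OF False] rooted_moment_finite_exponent[OF 2] *
    unfolding enn_powr_2[symmetric] enn_powr_powr enn2real_mult
    by simp
qed

lemma (in prob_space) rooted_moment_const_one [simp]: "rooted_moment M k q (\<lambda>_. 1) = 1"
  by (simp add: rooted_moment_def esssup_const emeasure_space_1)

text \<open>
  The essential supremum exceeds \<open>c\<close> iff, for some \<open>d > c\<close> in a fixed countable dense set, the
  section exceeds \<open>d\<close> on a set of positive measure; the measure of a section is measurable in
  the parameter.
\<close>

lemma (in sigma_finite_measure) esssup_parameter_measurable:
  fixes f :: "'b \<Rightarrow> 'a \<Rightarrow> ennreal"
  assumes f: "case_prod f \<in> borel_measurable (N \<Otimes>\<^sub>M M)"
  shows "(\<lambda>y. esssup M (f y)) \<in> borel_measurable N"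
proof (rule borel_measurableI_greater)
  note [measurable] = f
  fix c :: ennreal
  have fy: "f y \<in> borel_measurable M" if "y \<in> space N" for y using that by measurable
  obtain D :: "ennreal set" where D: "countable D"
    "\<And>x y. x < y \<Longrightarrow> \<exists>d\<in>D. x < d \<and> d < y"
    using countable_separating_set_dense_linorder by metis
  have "{y \<in> space N. c < esssup M (f y)}
      = (\<Union>d\<in>{d\<in>D. c < d}. {y \<in> space N. 0 < emeasure M {x \<in> space M. d < f y x}})"
  proof (intro set_eqI iffI)
    fix y assume y: "y \<in> {y \<in> space N. c < esssup M (f y)}"
    then obtain d where d: "d \<in> D" "c < d" "d < esssup M (f y)" using D(2) by blast
    then have "0 < emeasure M {x \<in> space M. d < f y x}"
      using esssup_pos_measure[OF fy] y by auto
    then show "y \<in> (\<Union>d\<in>{d\<in>D. c < d}. {y \<in> space N. 0 < emeasure M {x \<in> space M. d < f y x}})"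
      using d y by auto
  next
    fix y assume "y \<in> (\<Union>d\<in>{d\<in>D. c < d}. {y \<in> space N. 0 < emeasure M {x \<in> space M. d < f y x}})"
    then obtain d where d: "c < d" "y \<in> space N" "0 < emeasure M {x \<in> space M. d < f y x}" by auto
    have "\<not> esssup M (f y) \<le> c"
    proof
      assume le: "esssup M (f y) \<le> c"
      have "AE x in M. \<not> d < f y x"
        using esssup_AE[where f = "f y" and M = M]
        by eventually_elim (use le d(1) in auto)
      moreover have "{x \<in> space M. d < f y x} \<in> sets M" using fy[OF d(2)] by measurable
      ultimately have "emeasure M {x \<in> space M. d < f y x} = 0"
        by (subst (asm) AE_iff_measurable[OF _ refl]) auto
      then show False using d(3) by simp
    qed
    then show "y \<in> {y \<in> space N. c < esssup M (f y)}" using d by auto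
  qed
  also have "\<dots> \<in> sets N"
    using D(1) by (intro sets.countable_UN'') (auto intro: countable_subset[of _ D])
  finally show "{y \<in> space N. c < esssup M (f y)} \<in> sets N" .
qed

lemma (in sigma_finite_measure) rooted_moment_parameter_measurable:
  fixes f :: "'b \<Rightarrow> 'a \<Rightarrow> ennreal"
  assumes f: "case_prod f \<in> borel_measurable (N \<Otimes>\<^sub>M M)"
  shows "(\<lambda>y. rooted_moment M 1 q (f y)) \<in> borel_measurable N"
proof (cases "q = \<top>")
  case True
  then show ?thesis using esssup_parameter_measurable[OF f] by (simp add: rooted_moment_def)
next
  case False
  note [measurable] = f
  show ?thesis unfolding rooted_moment_finite_exponent[OF False] by measurable
qed

text \<open>
  After exchanging the integrals, Hoelder's inequality in \<open>x\<close> for each \<open>y\<close>, and then in \<open>y\<close>. With \<open>d = 1\<close> it says that the mixed norm of \<open>W\<close> dominates the mean of \<open>W\<close>, and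
  with \<open>W = 1\<close> that the mixed norm of \<open>d\<close> with doubled exponents dominates its mean square.
\<close>

lemma mixed_Holder:
  fixes W d :: "'a \<Rightarrow> 'b \<Rightarrow> ennreal"
  assumes "prob_space M" "prob_space N"
    and q1: "conjugate_exponents q1 q1'" and q2: "conjugate_exponents q2 q2'"
    and W: "case_prod W \<in> borel_measurable (M \<Otimes>\<^sub>M N)"
    and d: "case_prod d \<in> borel_measurable (M \<Otimes>\<^sub>M N)"
  shows "(\<integral>\<^sup>+x. \<integral>\<^sup>+y. W x y * (d x y)\<^sup>2 \<partial>N \<partial>M)
    \<le> Lq_norm N q2 (\<lambda>y. rooted_moment M 1 q1 (\<lambda>x. W x y))
      * (Lq_norm N (2 * q2') (\<lambda>y. rooted_moment M 1 (2 * q1') (\<lambda>x. d x y)))\<^sup>2"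
proof -
  interpret M: prob_space M by fact
  interpret N: prob_space N by fact
  interpret P: pair_sigma_finite M N ..
  note [measurable] = W d
  have W': "(\<lambda>(y, x). W x y) \<in> borel_measurable (N \<Otimes>\<^sub>M M)" by measurable
  have d': "(\<lambda>(y, x). d x y) \<in> borel_measurable (N \<Otimes>\<^sub>M M)" by measurable
  have [measurable]: "(\<lambda>y. rooted_moment M 1 q (\<lambda>x. W x y)) \<in> borel_measurable N"
    "(\<lambda>y. rooted_moment M 1 q (\<lambda>x. d x y)) \<in> borel_measurable N" for q
    using M.rooted_moment_parameter_measurable[of "\<lambda>y x. W x y", OF W']
      M.rooted_moment_parameter_measurable[of "\<lambda>y x. d x y", OF d'] by simp_all
  let ?w = "\<lambda>y. rooted_moment M 1 q1 (\<lambda>x. W x y)"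
  let ?d = "\<lambda>y. rooted_moment M 1 (2 * q1') (\<lambda>x. d x y)"
  have "(\<integral>\<^sup>+x. \<integral>\<^sup>+y. W x y * (d x y)\<^sup>2 \<partial>N \<partial>M) = (\<integral>\<^sup>+y. \<integral>\<^sup>+x. W x y * (d x y)\<^sup>2 \<partial>M \<partial>N)"
    by (rule P.Fubini'[symmetric]) measurable
  also have "\<dots> \<le> (\<integral>\<^sup>+y. ?w y * (?d y)\<^sup>2 \<partial>N)"
  proof (intro nn_integral_mono)
    fix y assume y: "y \<in> space N"
    then have [measurable]: "(\<lambda>x. W x y) \<in> borel_measurable M" "(\<lambda>x. d x y) \<in> borel_measurable M"
      by measurable
    have "(\<integral>\<^sup>+x. W x y * (d x y)\<^sup>2 \<partial>M) \<le> ?w y * rooted_moment M 1 q1' (\<lambda>x. (d x y)\<^sup>2)"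
      by (rule nn_integral_Holder[OF q1]) measurable
    also have "\<dots> \<le> ?w y * (?d y)\<^sup>2"
      by (intro mult_left_mono rooted_moment_square_le) simp_all
    finally show "(\<integral>\<^sup>+x. W x y * (d x y)\<^sup>2 \<partial>M) \<le> ?w y * (?d y)\<^sup>2" .
  qed
  also have "\<dots> \<le> rooted_moment N 1 q2 ?w * rooted_moment N 1 q2' (\<lambda>y. (?d y)\<^sup>2)"
    by (rule nn_integral_Holder[OF q2]) measurable
  also have "\<dots> \<le> rooted_moment N 1 q2 ?w * (rooted_moment N 1 (2 * q2') ?d)\<^sup>2"
    by (intro mult_left_mono rooted_moment_square_le) measurable
  finally show ?thesis by (simp add: Lq_norm_def)
qed

section \<open>Elementary estimates\<close>

lemma abs_exp_diff_le: "\<bar>exp x - exp y\<bar> \<le> max (exp x) (exp y) * \<bar>x - y\<bar>" for x y :: real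
proof (induction x y rule: linorder_wlog)
  case (le x y)
  have "1 + (x - y) \<le> exp (x - y)" by (rule exp_ge_add_one_self)
  then have "exp y * (1 + (x - y)) \<le> exp y * exp (x - y)" by (intro mult_left_mono) auto
  then have "exp y - exp x \<le> exp y * (y - x)"
    by (simp add: exp_diff algebra_simps)
  then show ?case using le by (simp add: max_def)
next
  case (sym x y)
  then show ?case by (simp add: max.commute abs_minus_commute)
qed

lemma sqrt_exp_diff_square_le:
  "(sqrt (exp x) - sqrt (exp y))\<^sup>2 \<le> (exp x + exp y) * (x - y)\<^sup>2 / 4" for x y :: real
proof -
  have s: "sqrt (exp x) = exp (x / 2)" for x :: real
    by (rule real_sqrt_unique) (auto simp: exp_double[symmetric])
  have "(sqrt (exp x) - sqrt (exp y))\<^sup>2 \<le> (max (exp (x / 2)) (exp (y / 2)) * \<bar>x / 2 - y / 2\<bar>)\<^sup>2"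
    unfolding s using abs_exp_diff_le[of "x / 2" "y / 2"]
    by (metis abs_ge_zero power2_abs power_mono)
  also have "\<dots> = (max (exp (x / 2)) (exp (y / 2)))\<^sup>2 * ((x - y)\<^sup>2 / 4)"
    by (simp add: power_mult_distrib diff_divide_distrib[symmetric] power_divide)
  also have "\<dots> \<le> (exp x + exp y) * ((x - y)\<^sup>2 / 4)"
    by (intro mult_right_mono) (auto simp: max_def exp_double[symmetric])
  finally show ?thesis by simp
qed

lemma exp_diff_square_le:
  "(exp x - exp y)\<^sup>2 \<le> (exp x + exp y)\<^sup>2 * (x - y)\<^sup>2" for x y :: real
proof -
  have "\<bar>exp x - exp y\<bar> \<le> (exp x + exp y) * \<bar>x - y\<bar>"
    by (rule order_trans[OF abs_exp_diff_le]) (auto intro: mult_right_mono)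
  then have "\<bar>exp x - exp y\<bar>\<^sup>2 \<le> ((exp x + exp y) * \<bar>x - y\<bar>)\<^sup>2"
    by (intro power_mono) auto
  then show ?thesis by (simp add: power_mult_distrib)
qed

text \<open>
  The mean value theorem for \<open>x \<mapsto> 1 / sqrt x\<close>, whose derivative has square \<open>1 / (4 * x ^ 3)\<close>;
  the proof factors differences of squares instead.
\<close>

lemma inverse_sqrt_diff_square_le:
  assumes "0 < z" "0 < y"
  shows "(1 / sqrt z - 1 / sqrt y)\<^sup>2 \<le> max (1 / z ^ 3) (1 / y ^ 3) * (z - y)\<^sup>2 / (4 :: real)"
  using assms
proof (induction z y rule: linorder_wlog)
  case (le z y)
  define a b where "a = sqrt z" and "b = sqrt y"
  have ab: "0 < a" "a \<le> b" "z = a\<^sup>2" "y = b\<^sup>2" using le by (auto simp: a_def b_def)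
  have *: "1 / b \<le> 1 / a" "1 / y ^ 3 \<le> 1 / z ^ 3"
    using ab le by (auto intro!: divide_left_mono power_mono)
  have "1 / a - 1 / b = (b - a) / (a * b)" using ab by (simp add: field_simps)
  also have "\<dots> \<le> (b - a) / (a * a)"
    using ab by (intro divide_left_mono mult_left_mono) auto
  also have "\<dots> = (2 * a) * (b - a) / (2 * a ^ 3)"
    using ab by (simp add: field_simps power3_eq_cube)
  also have "\<dots> \<le> (a + b) * (b - a) / (2 * a ^ 3)"
    using ab by (intro divide_right_mono mult_right_mono) auto
  also have "\<dots> = (y - z) / (2 * a ^ 3)"
    using ab by (simp add: field_simps power2_eq_square)
  finally have "(1 / a - 1 / b)\<^sup>2 \<le> ((y - z) / (2 * a ^ 3))\<^sup>2"
    using * by (intro power_mono) auto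
  also have "\<dots> = 1 / z ^ 3 * (y - z)\<^sup>2 / 4"
    using ab by (simp add: power_divide power_mult_distrib flip: power_mult)
  also have "\<dots> = max (1 / z ^ 3) (1 / y ^ 3) * (z - y)\<^sup>2 / 4"
    using * by (simp add: max_def power2_commute)
  finally show ?case by (simp add: a_def b_def)
next
  case (sym z y)
  then show ?case by (simp add: max.commute power2_commute)
qed

text \<open>
  If \<open>z \<le> y\<close>, bound the factor \<open>y\<close> below by \<open>z\<close> and keep \<open>1 / z ^ 3\<close>; otherwise keep
  \<open>1 / y ^ 3\<close>, which leaves \<open>1 / y\<^sup>2\<close>.
\<close>

lemma weight_ge_inverse_square:
  assumes "0 < z" "0 < y"
  shows "1 / z\<^sup>2 \<le> y * max (1 / z ^ 3) (1 / y ^ 3 :: real)"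
proof (cases "z \<le> y")
  case True
  have "1 / z\<^sup>2 = z * (1 / z ^ 3)" using assms by (simp add: field_simps eval_nat_numeral)
  also have "\<dots> \<le> y * max (1 / z ^ 3) (1 / y ^ 3)"
    using assms True by (intro mult_mono) auto
  finally show ?thesis .
next
  case False
  have "1 / z\<^sup>2 \<le> 1 / y\<^sup>2"
    using assms False by (intro divide_left_mono power_mono) auto
  also have "\<dots> = y * (1 / y ^ 3)" using assms by (simp add: field_simps eval_nat_numeral)
  also have "\<dots> \<le> y * max (1 / z ^ 3) (1 / y ^ 3)"
    using assms by (intro mult_left_mono) auto
  finally show ?thesis .
qed

text \<open>
  The factor that multiplies \<open>(exp (- \<Phi>) + exp (- \<Phi>\<^sub>N))\<^sup>2\<close> in hypothesis (b). By the two preceding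
  lemmas it dominates, for finite \<open>Y\<close>, both \<open>Z^-2\<close> and four times the ratio of
  \<open>Y * (1 / sqrt Z - 1 / sqrt Y)\<^sup>2\<close> to \<open>(Z - Y)\<^sup>2\<close>. It is infinite for infinite \<open>Y\<close>.
\<close>

definition weight :: "ennreal \<Rightarrow> ennreal \<Rightarrow> ennreal"
  where "weight Z Y = Y * max (inverse (Z ^ 3)) (inverse (Y ^ 3))"

lemma weight_ennreal:
  assumes "0 < z" "0 < y"
  shows "weight (ennreal z) (ennreal y) = ennreal (y * max (1 / z ^ 3) (1 / y ^ 3))"
  using assms
  by (simp add: weight_def ennreal_power inverse_ennreal max_def ennreal_mult inverse_eq_divide
      del: divide_le_0_1_iff)

lemma weight_top: "Z < \<top> \<Longrightarrow> weight Z \<top> = \<top>"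
  by (auto simp: weight_def ennreal_top_mult max_def ennreal_inverse_eq_0_iff power_less_top_ennreal less_top)

section \<open>Normalising constants and the Hellinger distance of posteriors\<close>

lemma (in prob_space) norm_const_pos:
  assumes [measurable]: "\<Phi> \<in> borel_measurable M"
  shows "0 < norm_const M \<Phi>"
proof -
  have "norm_const M \<Phi> \<noteq> 0"
    using emeasure_space_1 by (auto simp: norm_const_def nn_integral_0_iff_AE)
  then show ?thesis by (simp add: zero_less_iff_neq_zero)
qed

lemma norm_const_ennreal:
  assumes "prob_space M" "\<Phi> \<in> borel_measurable M" "norm_const M \<Phi> < \<top>"
  obtains z where "0 < z" "norm_const M \<Phi> = ennreal z"
  using prob_space.norm_const_pos[OF assms(1,2)] assms(3)
  by (cases "norm_const M \<Phi>") auto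

lemma (in prob_space) square_nn_integral_le:
  assumes [measurable]: "f \<in> borel_measurable M"
  shows "(\<integral>\<^sup>+x. f x \<partial>M)\<^sup>2 \<le> (\<integral>\<^sup>+x. (f x)\<^sup>2 \<partial>M)"
  using Cauchy_Schwarz_nn_integral[of f M "\<lambda>_. 1"] by (simp add: emeasure_space_1)

text \<open>
  The weight is at least \<open>Z^-2\<close>, so the integrand is at least \<open>(exp (- \<Phi>) / Z)\<^sup>2\<close>, the square of a
  function with mean 1.
\<close>

lemma (in prob_space) nn_integral_weight_ge_1:
  assumes [measurable]: "\<Phi> \<in> borel_measurable M" "\<Psi> \<in> borel_measurable M"
    and fin: "norm_const M \<Phi> < \<top>"
  shows "1 \<le> (\<integral>\<^sup>+u. weight (norm_const M \<Phi>) (norm_const M \<Psi>)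
                   * ennreal ((exp (- \<Phi> u) + exp (- \<Psi> u))\<^sup>2) \<partial>M)"
proof (cases "norm_const M \<Psi> = \<top>")
  case True
  then show ?thesis using fin by (simp add: weight_top ennreal_top_mult emeasure_space_1 add_pos_pos
      less_imp_neq[symmetric])
next
  case False
  obtain z where z: "0 < z" "norm_const M \<Phi> = ennreal z"
    using norm_const_ennreal[OF prob_space_axioms _ fin] by auto
  obtain y where y: "0 < y" "norm_const M \<Psi> = ennreal y"
    using norm_const_ennreal[of M \<Psi>] prob_space_axioms False by (auto simp: less_top)
  have "1 = (\<integral>\<^sup>+u. ennreal (1 / z) * ennreal (exp (- \<Phi> u)) \<partial>M)\<^sup>2"
    using z
    by (subst nn_integral_cmult) (simp_all add: norm_const_def[symmetric] ennreal_mult[symmetric])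
  also have "\<dots> \<le> (\<integral>\<^sup>+u. (ennreal (1 / z) * ennreal (exp (- \<Phi> u)))\<^sup>2 \<partial>M)"
    by (rule square_nn_integral_le) measurable
  also have "\<dots> \<le> (\<integral>\<^sup>+u. weight (norm_const M \<Phi>) (norm_const M \<Psi>)
                   * ennreal ((exp (- \<Phi> u) + exp (- \<Psi> u))\<^sup>2) \<partial>M)"
  proof (intro nn_integral_mono)
    fix u
    have "(1 / z * exp (- \<Phi> u))\<^sup>2 = 1 / z\<^sup>2 * (exp (- \<Phi> u))\<^sup>2"
      by (simp add: power_divide)
    also have "\<dots> \<le> y * max (1 / z ^ 3) (1 / y ^ 3) * (exp (- \<Phi> u) + exp (- \<Psi> u))\<^sup>2"
      using z y weight_ge_inverse_square[OF z(1) y(1)]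
      by (intro mult_mono power_mono) (auto simp: le_max_iff_disj)
    finally show "(ennreal (1 / z) * ennreal (exp (- \<Phi> u)))\<^sup>2
        \<le> weight (norm_const M \<Phi>) (norm_const M \<Psi>) * ennreal ((exp (- \<Phi> u) + exp (- \<Psi> u))\<^sup>2)"
      using z y by (simp add: weight_ennreal ennreal_mult[symmetric] ennreal_power ennreal_leI
           max_def del: divide_le_0_1_iff)
  qed
  finally show ?thesis .
qed

lemma (in prob_space) norm_const_diff_square_le:
  assumes [measurable]: "\<Phi> \<in> borel_measurable M" "\<Psi> \<in> borel_measurable M"
    and z: "norm_const M \<Phi> = ennreal z" "0 < z" and y: "norm_const M \<Psi> = ennreal y" "0 < y"
  shows "ennreal ((z - y)\<^sup>2) \<le> (\<integral>\<^sup>+u. ennreal ((exp (- \<Phi> u) - exp (- \<Psi> u))\<^sup>2) \<partial>M)"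
proof -
  have int: "integrable M (\<lambda>u. exp (- \<Phi> u))" "integrable M (\<lambda>u. exp (- \<Psi> u))"
    using z y by (auto intro!: integrableI_nonneg simp: norm_const_def)
  have val: "(\<integral>u. exp (- \<Phi> u) \<partial>M) = z" "(\<integral>u. exp (- \<Psi> u) \<partial>M) = y"
    using z y by (auto simp: integral_eq_nn_integral norm_const_def)
  have "z - y = (\<integral>u. exp (- \<Phi> u) - exp (- \<Psi> u) \<partial>M)"
    using int val by simp
  then have "ennreal \<bar>z - y\<bar> \<le> (\<integral>\<^sup>+u. ennreal \<bar>exp (- \<Phi> u) - exp (- \<Psi> u)\<bar> \<partial>M)"
    using integral_norm_bound_ennreal[of M "\<lambda>u. exp (- \<Phi> u) - exp (- \<Psi> u)"] int by simp
  then have "(ennreal \<bar>z - y\<bar>)\<^sup>2 \<le> (\<integral>\<^sup>+u. ennreal \<bar>exp (- \<Phi> u) - exp (- \<Psi> u)\<bar> \<partial>M)\<^sup>2"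
    by (intro power_mono) auto
  also have "\<dots> \<le> (\<integral>\<^sup>+u. (ennreal \<bar>exp (- \<Phi> u) - exp (- \<Psi> u)\<bar>)\<^sup>2 \<partial>M)"
    by (rule square_nn_integral_le) measurable
  finally show ?thesis by (simp add: ennreal_power)
qed

text \<open>
  Radon--Nikodym derivatives are only determined almost everywhere, so the explicit densities
  have to be substituted under the integral.
\<close>

lemma (in prob_space) hellinger_dist_posterior_square:
  assumes [measurable]: "\<Phi> \<in> borel_measurable M" "\<Psi> \<in> borel_measurable M"
    and z: "norm_const M \<Phi> = ennreal z" "0 < z" and y: "norm_const M \<Psi> = ennreal y" "0 < y"
  shows "(hellinger_dist M (posterior M \<Phi>) (posterior M \<Psi>))\<^sup>2
    = (\<integral>\<^sup>+u. ennreal ((sqrt (exp (- \<Phi> u) / z) - sqrt (exp (- \<Psi> u) / y))\<^sup>2) \<partial>M) / 2"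
proof -
  have RN: "AE u in M. enn2real (RN_deriv M (posterior M \<Theta>) u) = exp (- \<Theta> u) / c"
    if [measurable]: "\<Theta> \<in> borel_measurable M" and c: "norm_const M \<Theta> = ennreal c" "0 < c" for \<Theta> c
  proof -
    have "AE u in M. ennreal (exp (- \<Theta> u)) / norm_const M \<Theta> = RN_deriv M (posterior M \<Theta>) u"
      by (rule RN_deriv_unique) (auto simp: posterior_def)
    then show ?thesis
      by eventually_elim (use c in \<open>simp add: divide_ennreal eq_commute[of _ "RN_deriv _ _ _"]\<close>)
  qed
  have "(\<integral>\<^sup>+u. ennreal (\<bar>sqrt (enn2real (RN_deriv M (posterior M \<Phi>) u))
                  - sqrt (enn2real (RN_deriv M (posterior M \<Psi>) u))\<bar>\<^sup>2) \<partial>M)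
      = (\<integral>\<^sup>+u. ennreal ((sqrt (exp (- \<Phi> u) / z) - sqrt (exp (- \<Psi> u) / y))\<^sup>2) \<partial>M)"
    using RN[OF _ z] RN[OF _ y] by (intro nn_integral_cong_AE) auto
  then show ?thesis
    by (simp add: hellinger_dist_def enn_powr_half_square)
qed

text \<open>
  Here \<open>p\<close> compares the unnormalised densities and \<open>r\<close> the normalising constants. In the bound
  of \<open>r\<close>, the difference \<open>z - y\<close> is kept: it can be controlled only after integration, which turns
  \<open>exp b\<close> into \<open>y\<close>.
\<close>

lemma sqrt_density_diff_square_le:
  fixes z y a b :: real
  assumes "0 < z" "0 < y"
  shows "(sqrt (exp a / z) - sqrt (exp b / y))\<^sup>2
    \<le> (1 + y * max (1 / z ^ 3) (1 / y ^ 3) * (exp a + exp b)\<^sup>2) * (a - b)\<^sup>2 / 4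
      + max (1 / z ^ 3) (1 / y ^ 3) * (z - y)\<^sup>2 / 2 * exp b"
proof -
  define p where "p = (sqrt (exp a) - sqrt (exp b)) / sqrt z"
  define r where "r = sqrt (exp b) * (1 / sqrt z - 1 / sqrt y)"
  define s where "s = (exp a + exp b) / z"
  have "sqrt (exp a / z) - sqrt (exp b / y) = p + r"
    using assms by (simp add: p_def r_def real_sqrt_divide field_simps)
  moreover have "(p + r)\<^sup>2 \<le> 2 * p\<^sup>2 + 2 * r\<^sup>2"
    using sum_squares_bound[of p r] by (simp add: power2_sum)
  ultimately have split: "(sqrt (exp a / z) - sqrt (exp b / y))\<^sup>2 \<le> 2 * p\<^sup>2 + 2 * r\<^sup>2" by simp
  have "p\<^sup>2 = (sqrt (exp a) - sqrt (exp b))\<^sup>2 / z"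
    using assms by (simp add: p_def power_divide)
  also have "\<dots> \<le> ((exp a + exp b) * (a - b)\<^sup>2 / 4) / z"
    using assms sqrt_exp_diff_square_le by (intro divide_right_mono) auto
  also have "\<dots> = s * ((a - b)\<^sup>2 / 4)" by (simp add: s_def)
  \<comment> \<open>Squaring \<open>s\<close> produces the factor \<open>1 / z\<^sup>2\<close> that the weight dominates.\<close>
  also have "\<dots> \<le> (1 + s\<^sup>2) / 2 * ((a - b)\<^sup>2 / 4)"
    using sum_squares_bound[of 1 s] by (intro mult_right_mono) auto
  also have "\<dots> \<le> (1 + y * max (1 / z ^ 3) (1 / y ^ 3) * (exp a + exp b)\<^sup>2) / 2 * ((a - b)\<^sup>2 / 4)"
  proof -
    have "s\<^sup>2 = 1 / z\<^sup>2 * (exp a + exp b)\<^sup>2" by (simp add: s_def power_divide)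
    also have "\<dots> \<le> y * max (1 / z ^ 3) (1 / y ^ 3) * (exp a + exp b)\<^sup>2"
      using weight_ge_inverse_square[OF assms] by (intro mult_right_mono) auto
    finally show ?thesis by (intro mult_right_mono divide_right_mono) auto
  qed
  finally have 1: "2 * p\<^sup>2 \<le> (1 + y * max (1 / z ^ 3) (1 / y ^ 3) * (exp a + exp b)\<^sup>2) * (a - b)\<^sup>2 / 4"
    by simp
  have "r\<^sup>2 = exp b * (1 / sqrt z - 1 / sqrt y)\<^sup>2" by (simp add: r_def power_mult_distrib)
  also have "\<dots> \<le> exp b * (max (1 / z ^ 3) (1 / y ^ 3) * (z - y)\<^sup>2 / 4)"
    using inverse_sqrt_diff_square_le[OF assms] by (intro mult_left_mono) auto
  finally have 2: "2 * r\<^sup>2 \<le> max (1 / z ^ 3) (1 / y ^ 3) * (z - y)\<^sup>2 / 2 * exp b"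
    by (simp add: algebra_simps)
  show ?thesis using split 1 2 by linarith
qed

text \<open>
  Let \<open>W\<close> be the weighted term and \<open>d\<^sup>2\<close> the squared difference of the potentials. The two parts
  of the pointwise bound contribute at most \<open>(1 + W) * d\<^sup>2 / 4\<close> and, after integration,
  \<open>W * d\<^sup>2 / 2\<close>; the coefficients \<open>1 / 4\<close> and \<open>3 / 4\<close> of their sum are rounded up to 1.
\<close>

lemma (in prob_space) hellinger_dist_posterior_square_le:
  assumes [measurable]: "\<Phi> \<in> borel_measurable M" "\<Psi> \<in> borel_measurable M"
    and fin: "norm_const M \<Phi> < \<top>" "norm_const M \<Psi> < \<top>"
  shows "(hellinger_dist M (posterior M \<Phi>) (posterior M \<Psi>))\<^sup>2
    \<le> (\<integral>\<^sup>+u. (1 + weight (norm_const M \<Phi>) (norm_const M \<Psi>)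
                  * ennreal ((exp (- \<Phi> u) + exp (- \<Psi> u))\<^sup>2))
             * (ennreal \<bar>\<Phi> u - \<Psi> u\<bar>)\<^sup>2 \<partial>M) / 2"
proof -
  obtain z where z: "norm_const M \<Phi> = ennreal z" "0 < z"
    using norm_const_ennreal[OF prob_space_axioms _ fin(1)] by auto
  obtain y where y: "norm_const M \<Psi> = ennreal y" "0 < y"
    using norm_const_ennreal[OF prob_space_axioms _ fin(2)] by auto
  define m where "m = max (1 / z ^ 3) (1 / y ^ 3)"
  have m: "0 < m" using z by (simp add: m_def less_max_iff_disj)
  define S where "S = (\<lambda>u. (exp (- \<Phi> u) + exp (- \<Psi> u))\<^sup>2)"
  define d where "d = (\<lambda>u. (\<Phi> u - \<Psi> u)\<^sup>2)"
  have [measurable]: "S \<in> borel_measurable M" "d \<in> borel_measurable M"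
    unfolding S_def d_def by measurable
  have nonneg: "0 \<le> S u" "0 \<le> d u" for u by (auto simp: S_def d_def)
  have exp_le: "(exp (- \<Phi> u) - exp (- \<Psi> u))\<^sup>2 \<le> S u * d u" for u
    using exp_diff_square_le[of "- \<Phi> u" "- \<Psi> u"] by (simp add: S_def d_def power2_commute)
  have sqrt_le: "(sqrt (exp (- \<Phi> u) / z) - sqrt (exp (- \<Psi> u) / y))\<^sup>2
      \<le> (1 + y * m * S u) * d u / 4 + m * (z - y)\<^sup>2 / 2 * exp (- \<Psi> u)" for u
    using sqrt_density_diff_square_le[OF z(2) y(2), of "- \<Phi> u" "- \<Psi> u"]
    by (simp add: m_def S_def d_def power2_commute[of "\<Phi> u" "\<Psi> u"])
  have "(\<integral>\<^sup>+u. ennreal (m * (z - y)\<^sup>2 / 2 * exp (- \<Psi> u)) \<partial>M)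
      = ennreal (m * (z - y)\<^sup>2 / 2) * ennreal y"
    unfolding y(1)[symmetric] norm_const_def using m
    by (subst nn_integral_cmult[symmetric]) (auto simp: ennreal_mult[symmetric])
  also have "\<dots> = ennreal (y * m / 2) * ennreal ((z - y)\<^sup>2)"
    using m y by (simp add: ennreal_mult[symmetric] mult_ac)
  also have "\<dots> \<le> ennreal (y * m / 2) * (\<integral>\<^sup>+u. ennreal ((exp (- \<Phi> u) - exp (- \<Psi> u))\<^sup>2) \<partial>M)"
    using norm_const_diff_square_le[OF _ _ z y] by (intro mult_left_mono) auto
  also have "\<dots> \<le> ennreal (y * m / 2) * (\<integral>\<^sup>+u. ennreal (S u * d u) \<partial>M)"
    using exp_le by (intro mult_left_mono nn_integral_mono ennreal_leI) auto
  also have "\<dots> = (\<integral>\<^sup>+u. ennreal (y * m / 2 * (S u * d u)) \<partial>M)"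
    using m y nonneg
    by (subst nn_integral_cmult[symmetric]) (auto simp: ennreal_mult[symmetric])
  finally have const: "(\<integral>\<^sup>+u. ennreal (m * (z - y)\<^sup>2 / 2 * exp (- \<Psi> u)) \<partial>M)
      \<le> (\<integral>\<^sup>+u. ennreal (y * m / 2 * (S u * d u)) \<partial>M)" .
  have "(\<integral>\<^sup>+u. ennreal ((sqrt (exp (- \<Phi> u) / z) - sqrt (exp (- \<Psi> u) / y))\<^sup>2) \<partial>M)
      \<le> (\<integral>\<^sup>+u. ennreal ((1 + y * m * S u) * d u / 4)
               + ennreal (m * (z - y)\<^sup>2 / 2 * exp (- \<Psi> u)) \<partial>M)"
    using sqrt_le m y nonneg
    by (intro nn_integral_mono) (simp add: ennreal_plus[symmetric] ennreal_leI del: ennreal_plus)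
  also have "\<dots> \<le> (\<integral>\<^sup>+u. ennreal ((1 + y * m * S u) * d u / 4) \<partial>M)
               + (\<integral>\<^sup>+u. ennreal (y * m / 2 * (S u * d u)) \<partial>M)"
    using const by (subst nn_integral_add) (auto intro: add_left_mono)
  also have "\<dots> = (\<integral>\<^sup>+u. ennreal ((1 + y * m * S u) * d u / 4 + y * m / 2 * (S u * d u)) \<partial>M)"
    using m y nonneg by (subst nn_integral_add[symmetric]) (auto intro!: nn_integral_cong)
  also have "\<dots> \<le> (\<integral>\<^sup>+u. ennreal ((1 + y * m * S u) * d u) \<partial>M)"
  proof (intro nn_integral_mono ennreal_leI)
    fix u
    have "0 \<le> 3 / 4 * d u + 1 / 4 * (y * m * (S u * d u))"
      using m y nonneg by auto
    also have "\<dots> = (1 + y * m * S u) * d u - ((1 + y * m * S u) * d u / 4 + y * m / 2 * (S u * d u))"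
      by (simp add: field_simps)
    finally show "(1 + y * m * S u) * d u / 4 + y * m / 2 * (S u * d u) \<le> (1 + y * m * S u) * d u"
      by (simp only: diff_ge_0_iff_ge)
  qed
  also have "\<dots> = (\<integral>\<^sup>+u. (1 + weight (norm_const M \<Phi>) (norm_const M \<Psi>)
                  * ennreal ((exp (- \<Phi> u) + exp (- \<Psi> u))\<^sup>2)) * (ennreal \<bar>\<Phi> u - \<Psi> u\<bar>)\<^sup>2 \<partial>M)"
    using m y nonneg
    by (intro nn_integral_cong)
      (simp add: z(1) y(1) weight_ennreal[OF z(2) y(2)] m_def[symmetric] S_def d_def
        ennreal_power ennreal_mult ennreal_plus)
  finally show ?thesis
    unfolding hellinger_dist_posterior_square[OF assms(1,2) z y]
    by (intro divide_right_mono_ennreal)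
qed

section \<open>The error bound for the sample approximate posterior\<close>

theorem theorem3p2:
  fixes \<mu>0 :: "'u::{banach, second_countable_topology} measure"
    and \<Phi> :: "'u \<Rightarrow> real"
    and \<Omega> :: "'w measure"
    and \<nu> :: "nat \<Rightarrow> 'w measure"
    and \<Phi>N :: "nat \<Rightarrow> 'w \<Rightarrow> 'u \<Rightarrow> real"
    and Z :: ennreal
    and ZN :: "nat \<Rightarrow> 'w \<Rightarrow> ennreal"
    and q1 q1' q2 q2' :: ennreal
    and D1 D2 :: real
  assumes prior: "prob_space \<mu>0" "sets \<mu>0 = sets borel"
    and meas: "\<Phi> \<in> borel_measurable borel"
    and Z_def: "Z = norm_const \<mu>0 \<Phi>"
    and Z_range: "0 < Z" "Z < \<top>"
    and nu: "\<And>N. prob_space (\<nu> N)" "\<And>N. sets (\<nu> N) = sets \<Omega>"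
    and measN: "\<And>N. (\<lambda>(\<omega>, u). \<Phi>N N \<omega> u) \<in> borel_measurable (\<Omega> \<Otimes>\<^sub>M borel)"
    and ZN_def: "\<And>N \<omega>. ZN N \<omega> = norm_const \<mu>0 (\<Phi>N N \<omega>)"
    and conj: "conjugate_exponents q1 q1'" "conjugate_exponents q2 q2'"
    and D_nonneg: "0 \<le> D1" "0 \<le> D2"
    and a: "\<And>N. Lq_norm \<mu>0 q2
              (\<lambda>u. rooted_moment (\<nu> N) 2 q1
                 (\<lambda>\<omega>. ennreal (exp (- \<Phi> u / 2) + exp (- \<Phi>N N \<omega> u / 2)))) \<le> ennreal D1"
    and b: "\<And>N. Lq_norm \<mu>0 q2
              (\<lambda>u. rooted_moment (\<nu> N) 1 q1
                 (\<lambda>\<omega>. ZN N \<omega> * max (inverse (Z ^ 3)) (inverse (ZN N \<omega> ^ 3))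
                       * ennreal ((exp (- \<Phi> u) + exp (- \<Phi>N N \<omega> u))\<^sup>2))) \<le> ennreal D2"
  shows "\<forall>N. enn_powr (\<integral>\<^sup>+ \<omega>. (hellinger_dist \<mu>0 (posterior \<mu>0 \<Phi>) (posterior \<mu>0 (\<Phi>N N \<omega>)))\<^sup>2 \<partial>\<nu> N) (1 / 2)
           \<le> ennreal (D1 + D2)
             * Lq_norm \<mu>0 (2 * q2')
                 (\<lambda>u. rooted_moment (\<nu> N) 1 (2 * q1') (\<lambda>\<omega>. ennreal \<bar>\<Phi> u - \<Phi>N N \<omega> u\<bar>))"
proof
  fix N
  interpret \<mu>0: prob_space \<mu>0 by fact
  interpret \<nu>: prob_space "\<nu> N" by (rule nu)
  note [measurable_cong] = prior(2)
  have [measurable]: "\<Phi> \<in> borel_measurable \<mu>0"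
    using meas by measurable
  have [measurable]: "case_prod (\<Phi>N N) \<in> borel_measurable (\<nu> N \<Otimes>\<^sub>M \<mu>0)"
    using measN[of N] measurable_cong_sets[OF sets_pair_measure_cong[OF nu(2) prior(2)] refl] by blast
  have \<Phi>N_meas: "\<Phi>N N \<omega> \<in> borel_measurable \<mu>0" if "\<omega> \<in> space (\<nu> N)" for \<omega>
    using that by measurable
  have [measurable]: "(\<lambda>\<omega>. norm_const \<mu>0 (\<Phi>N N \<omega>)) \<in> borel_measurable (\<nu> N)"
    unfolding norm_const_def by measurable

  define W where "W \<omega> u = weight Z (norm_const \<mu>0 (\<Phi>N N \<omega>))
      * ennreal ((exp (- \<Phi> u) + exp (- \<Phi>N N \<omega> u))\<^sup>2)" for \<omega> u
  define d where "d \<omega> u = ennreal \<bar>\<Phi> u - \<Phi>N N \<omega> u\<bar>" for \<omega> u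
  define X where "X = Lq_norm \<mu>0 (2 * q2') (\<lambda>u. rooted_moment (\<nu> N) 1 (2 * q1') (\<lambda>\<omega>. d \<omega> u))"
  have W_meas [measurable]: "case_prod W \<in> borel_measurable (\<nu> N \<Otimes>\<^sub>M \<mu>0)"
    unfolding W_def weight_def by measurable
  have d_meas [measurable]: "case_prod d \<in> borel_measurable (\<nu> N \<Otimes>\<^sub>M \<mu>0)"
    unfolding d_def by measurable
  note Holder = mixed_Holder[OF nu(1) prior(1) conj]
  have W_norm: "Lq_norm \<mu>0 q2 (\<lambda>u. rooted_moment (\<nu> N) 1 q1 (\<lambda>\<omega>. W \<omega> u)) \<le> ennreal D2"
    using b[of N] by (simp add: W_def weight_def ZN_def)

  have W_int: "(\<integral>\<^sup>+\<omega>. \<integral>\<^sup>+u. W \<omega> u \<partial>\<mu>0 \<partial>\<nu> N) \<le> ennreal D2"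
    using Holder[OF W_meas, of "\<lambda>_ _. 1"] W_norm by (simp add: Lq_norm_def)
  have "(1 :: ennreal) = (\<integral>\<^sup>+\<omega>. 1 \<partial>\<nu> N)" by (simp add: \<nu>.emeasure_space_1)
  also have "\<dots> \<le> (\<integral>\<^sup>+\<omega>. \<integral>\<^sup>+u. W \<omega> u \<partial>\<mu>0 \<partial>\<nu> N)"
    using \<mu>0.nn_integral_weight_ge_1[of \<Phi>] \<Phi>N_meas Z_range unfolding W_def Z_def
    by (intro nn_integral_mono) auto
  finally have D2: "1 \<le> D2" using W_int by (auto dest: order_trans)

  \<comment> \<open>An infinite normalising constant makes \<open>W\<close> infinite, so this occurs only on a null set.\<close>
  have "AE \<omega> in \<nu> N. (\<integral>\<^sup>+u. W \<omega> u \<partial>\<mu>0) \<noteq> \<infinity>"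
    using W_int by (intro nn_integral_PInf_AE) (auto simp: top_unique)
  then have ZN_fin: "AE \<omega> in \<nu> N. norm_const \<mu>0 (\<Phi>N N \<omega>) < \<top>"
  proof eventually_elim
    case (elim \<omega>)
    show ?case
    proof (rule ccontr)
      assume "\<not> norm_const \<mu>0 (\<Phi>N N \<omega>) < \<top>"
      then have "W \<omega> u = \<top>" for u
        using Z_range add_pos_pos[of "exp (- \<Phi> u)" "exp (- \<Phi>N N \<omega> u)"]
        by (simp add: W_def weight_top ennreal_top_mult not_less top_unique)
      then show False using elim by (simp add: \<mu>0.emeasure_space_1)
    qed
  qed
  have "(\<integral>\<^sup>+\<omega>. (hellinger_dist \<mu>0 (posterior \<mu>0 \<Phi>) (posterior \<mu>0 (\<Phi>N N \<omega>)))\<^sup>2 \<partial>\<nu> N)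
      \<le> (\<integral>\<^sup>+\<omega>. (\<integral>\<^sup>+u. (1 + W \<omega> u) * (d \<omega> u)\<^sup>2 \<partial>\<mu>0) / 2 \<partial>\<nu> N)"
  proof (intro nn_integral_mono_AE, use ZN_fin AE_space in eventually_elim)
    case (elim \<omega>)
    then show ?case
      using \<mu>0.hellinger_dist_posterior_square_le[of \<Phi> "\<Phi>N N \<omega>"] \<Phi>N_meas Z_range
      unfolding W_def d_def Z_def by simp
  qed
  also have "\<dots> = ((\<integral>\<^sup>+\<omega>. \<integral>\<^sup>+u. 1 * (d \<omega> u)\<^sup>2 \<partial>\<mu>0 \<partial>\<nu> N)
      + (\<integral>\<^sup>+\<omega>. \<integral>\<^sup>+u. W \<omega> u * (d \<omega> u)\<^sup>2 \<partial>\<mu>0 \<partial>\<nu> N)) / 2"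
    by (simp add: nn_integral_divide distrib_right nn_integral_add cong: nn_integral_cong)
  also have "\<dots> \<le> (1 * X\<^sup>2 + ennreal D2 * X\<^sup>2) / 2"
  proof (intro divide_right_mono_ennreal add_mono)
    show "(\<integral>\<^sup>+\<omega>. \<integral>\<^sup>+u. 1 * (d \<omega> u)\<^sup>2 \<partial>\<mu>0 \<partial>\<nu> N) \<le> 1 * X\<^sup>2"
      using Holder[OF _ d_meas, of "\<lambda>_ _. 1"] by (simp add: X_def Lq_norm_def)
    show "(\<integral>\<^sup>+\<omega>. \<integral>\<^sup>+u. W \<omega> u * (d \<omega> u)\<^sup>2 \<partial>\<mu>0 \<partial>\<nu> N) \<le> ennreal D2 * X\<^sup>2"
      using order_trans[OF Holder[OF W_meas d_meas] mult_right_mono[OF W_norm]] by (simp add: X_def)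
  qed
  also have "\<dots> = ennreal ((1 + D2) / 2) * X\<^sup>2"
  proof -
    have "(1 + ennreal D2) / 2 = ennreal ((1 + D2) / 2)"
      using D2 by (simp add: divide_ennreal ennreal_plus[symmetric] del: ennreal_plus
          flip: ennreal_numeral ennreal_1)
    moreover have "(1 * X\<^sup>2 + ennreal D2 * X\<^sup>2) / 2 = (1 + ennreal D2) / 2 * X\<^sup>2"
      unfolding distrib_right[symmetric] by (simp only: divide_ennreal_def mult_ac)
    ultimately show ?thesis by simp
  qed
  also have "\<dots> \<le> (ennreal (D1 + D2) * X)\<^sup>2"
  proof -
    have "(1 + D2) / 2 \<le> D2" using D2 by simp
    also have "D2 \<le> D2\<^sup>2" using D2 by (simp add: power2_eq_square)
    also have "D2\<^sup>2 \<le> (D1 + D2)\<^sup>2" using D2 D_nonneg by (intro power_mono) auto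
    finally show ?thesis
      using D_nonneg by (simp add: power_mult_distrib ennreal_power mult_right_mono ennreal_leI
          del: ennreal_plus)
  qed
  finally show "enn_powr (\<integral>\<^sup>+ \<omega>. (hellinger_dist \<mu>0 (posterior \<mu>0 \<Phi>) (posterior \<mu>0 (\<Phi>N N \<omega>)))\<^sup>2 \<partial>\<nu> N) (1 / 2)
           \<le> ennreal (D1 + D2)
             * Lq_norm \<mu>0 (2 * q2')
                 (\<lambda>u. rooted_moment (\<nu> N) 1 (2 * q1') (\<lambda>\<omega>. ennreal \<bar>\<Phi> u - \<Phi>N N \<omega> u\<bar>))"
    unfolding d_def[symmetric] X_def[symmetric]
    by (subst enn_powr_square_half[symmetric]) (rule enn_powr_mono, auto)
qed

end
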